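(* Let $u_0\in L^\infty(\mathbb R)\cap C^1(\mathbb R\setminus\{0\})$ satisfy $\lim_{|x|\rightarrow+\infty}|x\,u_0'(x)|=0$. Let $u(x,t)$ be the solution to the Cauchy problem $u_t=u_{xx}$ on $\mathbb R\times(0,+\infty)$, $u(x,0)=u_0(x)$ for $x\in\mathbb R$. Then, for all $L>0$, $$\lim_{t\rightarrow+\infty}\ \sup_{x\in[-L,+L]}\left|u(\sqrt t\,x,t)-\left(F(-x)\,u_0(-\sqrt t)+F(+x)\,u_0(+\sqrt t)\right)\right|=0,$$ where $F(z):=\frac{1}{2\sqrt\pi}\int_{-\infty}^z e^{-\frac{y^2}{4}}\,dy$.
   Context: The solution to the Cauchy problem of the heat equation with initial value $u_0$ is the one given by the heat kernel: $u(x,t)=\frac{1}{2\sqrt{\pi t}}\int_{-\infty}^{+\infty}e^{-\frac{(x-y)^2}{4t}}u_0(y)\,dy$ for $(x,t)\in\mathbb R\times(0,+\infty)$. The condition $u_0\in L^\infty(\mathbb R)\cap C^1(\mathbb R\setminus\{0\})$ means that $u_0$ is bounded and continuously differentiable on $\mathbb R\setminus\{0\}$; no regularity at $0$ is assumed. *)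

theory Defs
  imports "HOL-Analysis.Analysis"
begin

text \<open>
  The solution of the Cauchy problem for \<open>u_t = u_xx\<close> on the line with initial value \<open>u0\<close>
  is the one given by the heat kernel (bounded solutions are unique, arbitrary ones are not).
  The formula is meaningful only for \<open>t > 0\<close>.
\<close>

definition heat_solution :: "(real \<Rightarrow> real) \<Rightarrow> real \<Rightarrow> real \<Rightarrow> real" where
  "heat_solution u0 x t =
     1 / (2 * sqrt (pi * t)) * (LBINT y. exp (- ((x - y)\<^sup>2 / (4 * t))) * u0 y)"

definition F :: "real \<Rightarrow> real" where
  "F z = 1 / (2 * sqrt pi) * (LBINT y:{..z}. exp (- (y\<^sup>2 / 4)))"

end

theory Submission
  imports Defs "HOL-Probability.Distributions"
begin

text \<open>
  With \<open>s = sqrt t\<close> and the substitution \<open>y = s z\<close>, the quantity to be estimated is the integral of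
  \<open>exp (- (x - z)\<^sup>2 / 4) / (2 sqrt \<pi>)\<close> against \<open>u0 (s z) - u0 (s sgn z)\<close>.  For \<open>\<bar>x\<bar> \<le> L\<close> the kernel is
  at most \<open>exp (L\<^sup>2 / 4) exp (- z\<^sup>2 / 8)\<close>, which no longer depends on \<open>x\<close>.  By the mean value
  theorem and \<open>x u0'(x) \<rightarrow> 0\<close>, the difference tends to \<open>0\<close> for every \<open>z \<noteq> 0\<close>, so that dominated
  convergence applies.
\<close>

text \<open>By the mean value theorem the difference is \<open>(s * b - s * a) * f' \<xi>\<close>
  with \<open>\<xi> > s * a\<close>, hence at most \<open>(b - a) / a\<close> times
  \<open>\<bar>\<xi> * f' \<xi>\<bar>\<close>. This ratio does not depend on \<open>s\<close>, and
  \<open>\<xi>\<close> is large with \<open>s\<close>.\<close>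

lemma tendsto_diff_dilation_less:
  fixes f f' :: "real \<Rightarrow> real"
  assumes deriv: "\<And>x. x > 0 \<Longrightarrow> (f has_real_derivative f' x) (at x)"
    and lim: "((\<lambda>x. x * f' x) \<longlongrightarrow> 0) at_top"
    and ab: "0 < a" "a < b"
  shows "((\<lambda>s. f (s * b) - f (s * a)) \<longlongrightarrow> 0) at_top"
proof (rule tendstoI)
  fix e :: real assume "e > 0"
  \<comment> \<open>Chosen so that \<open>(b - a) / a * d = e\<close>.\<close>
  define d where "d = e * a / (b - a)"
  have "d > 0" using ab \<open>e > 0\<close> by (simp add: d_def)
  from tendstoD[OF lim this] obtain N where N: "\<And>x. x \<ge> N \<Longrightarrow> \<bar>x * f' x\<bar> < d"
    by (auto simp: eventually_at_top_linorder)
  \<comment> \<open>The \<open>1\<close> keeps \<open>s\<close> positive; \<open>N / a\<close>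
    places the whole interval from \<open>s * a\<close> to \<open>s * b\<close> beyond
    \<open>N\<close>.\<close>
  have "dist (f (s * b) - f (s * a)) 0 < e" if s: "s \<ge> max 1 (N / a)" for s
  proof -
    have "s > 0" "s * a < s * b" "s * a > 0" using s ab by auto
    have sa: "N \<le> s * a" using s ab by (simp add: pos_divide_le_eq)
    obtain \<xi> where \<xi>: "s * a < \<xi>" "\<xi> < s * b"
      and eq: "f (s * b) - f (s * a) = (s * b - s * a) * f' \<xi>"
      using MVT2[OF \<open>s * a < s * b\<close>, of f f'] deriv \<open>s * a > 0\<close> by (metis less_le_trans)
    have "\<xi> > 0" using \<xi> \<open>s * a > 0\<close> by linarith
    have "a * \<bar>f (s * b) - f (s * a)\<bar> = (b - a) * ((s * a) * \<bar>f' \<xi>\<bar>)"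
      using ab \<open>s > 0\<close> unfolding eq by (simp add: abs_mult right_diff_distrib[symmetric])
    also have "\<dots> \<le> (b - a) * \<bar>\<xi> * f' \<xi>\<bar>"
      unfolding abs_mult using ab \<xi> \<open>\<xi> > 0\<close> by (intro mult_left_mono mult_right_mono) auto
    also have "\<dots> < (b - a) * d"
      using N[of \<xi>] sa \<xi> ab by (intro mult_strict_left_mono) auto
    also have "\<dots> = a * e" using ab by (simp add: d_def)
    finally show ?thesis using ab by simp
  qed
  then show "\<forall>\<^sub>F s in at_top. dist (f (s * b) - f (s * a)) 0 < e"
    unfolding eventually_at_top_linorder by blast
qed

lemma tendsto_diff_dilation:
  fixes f f' :: "real \<Rightarrow> real"
  assumes deriv: "\<And>x. x > 0 \<Longrightarrow> (f has_real_derivative f' x) (at x)"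
    and lim: "((\<lambda>x. x * f' x) \<longlongrightarrow> 0) at_top"
    and ab: "0 < a" "0 < b"
  shows "((\<lambda>s. f (s * b) - f (s * a)) \<longlongrightarrow> 0) at_top"
proof (cases a b rule: linorder_cases)
  case less
  then show ?thesis using tendsto_diff_dilation_less[OF deriv lim] ab by blast
next
  case greater
  then show ?thesis
    using tendsto_minus[OF tendsto_diff_dilation_less[OF deriv lim, of b a]] ab by simp
qed simp

text \<open>Parabolic scaling: the exponent is invariant, and the Jacobian \<open>s\<close> cancels
  the \<open>s\<close> that comes out of \<open>sqrt (pi * s\<^sup>2)\<close>.\<close>

lemma heat_solution_rescaled:
  assumes "s > 0"
  shows "heat_solution u (s * x) (s\<^sup>2)
    = 1 / (2 * sqrt pi) * (LBINT z. exp (- ((x - z)\<^sup>2 / 4)) * u (s * z))"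
proof -
  have "(s * x - s * z)\<^sup>2 / (4 * s\<^sup>2) = (x - z)\<^sup>2 / 4" for z
    using assms by (simp add: right_diff_distrib[symmetric] power_mult_distrib)
  moreover have "(LBINT y. exp (- ((s * x - y)\<^sup>2 / (4 * s\<^sup>2))) * u y)
      = s * (LBINT z. exp (- ((s * x - s * z)\<^sup>2 / (4 * s\<^sup>2))) * u (s * z))"
    using lborel_integral_real_affine[of s "\<lambda>y. exp (- ((s * x - y)\<^sup>2 / (4 * s\<^sup>2))) * u y" 0] assms
    by simp
  ultimately have "(LBINT y. exp (- ((s * x - y)\<^sup>2 / (4 * s\<^sup>2))) * u y)
      = s * (LBINT z. exp (- ((x - z)\<^sup>2 / 4)) * u (s * z))"
    by (simp only:)
  then show ?thesis
    using assms by (simp add: heat_solution_def real_sqrt_mult)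
qed

text \<open>The reflection \<open>y = x - z\<close> gives \<open>F\<close> the same kernel as the
  rescaled solution, so that the two integrals can be subtracted.\<close>

lemma F_eq_integral_right:
  "F x = 1 / (2 * sqrt pi) * (LBINT z. exp (- ((x - z)\<^sup>2 / 4)) * indicator {0..} z)"
proof -
  have "indicator {..x} (x - z) = (indicator {0..} z :: real)" for z
    by (simp add: indicator_def)
  then show ?thesis
    using lborel_integral_real_affine[of "-1" "\<lambda>y. indicator {..x} y * exp (- (y\<^sup>2 / 4))" x]
    by (simp add: F_def set_lebesgue_integral_def mult.commute)
qed

text \<open>Here the translation \<open>y = z - x\<close> is enough, since the kernel is
  even.\<close>

lemma F_eq_integral_left:
  "F (- x) = 1 / (2 * sqrt pi) * (LBINT z. exp (- ((x - z)\<^sup>2 / 4)) * indicator {..0} z)"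
proof -
  have "indicator {..- x} (z - x) = (indicator {..0} z :: real)" for z
    by (simp add: indicator_def)
  then show ?thesis
    using lborel_integral_real_affine[of 1 "\<lambda>y. indicator {..- x} y * exp (- (y\<^sup>2 / 4))" "- x"]
    by (simp add: F_def set_lebesgue_integral_def mult.commute power2_commute)
qed

text \<open>Up to a constant this is the normal density with mean 0 and standard deviation
  2.\<close>

lemma integrable_exp_neg_square_div_8: "integrable lborel (\<lambda>z::real. exp (- (z\<^sup>2 / 8)))"
proof -
  have "integrable lborel (\<lambda>z. sqrt (2 * pi * 2\<^sup>2) * normal_density 0 2 z)"
    by (intro integrable_mult_right integrable_normal_density) simp
  then show ?thesis by (simp add: normal_density_def)
qed

text \<open>Completing the square: giving up half of the decay in \<open>z\<close> absorbs the cross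
  term, leaving the nonnegative remainder \<open>(2 * x - z)\<^sup>2 / 8\<close>.\<close>

lemma heat_kernel_le:
  fixes x z L :: real
  assumes "\<bar>x\<bar> \<le> L"
  shows "exp (- ((x - z)\<^sup>2 / 4)) \<le> exp (L\<^sup>2 / 4) * exp (- (z\<^sup>2 / 8))"
proof -
  have "x\<^sup>2 \<le> L\<^sup>2" using assms using power_mono[of "\<bar>x\<bar>" L 2] by simp
  moreover have "(x - z)\<^sup>2 / 4 = z\<^sup>2 / 8 - x\<^sup>2 / 4 + (2 * x - z)\<^sup>2 / 8"
    by (simp add: power2_eq_square field_simps)
  moreover have "0 \<le> (2 * x - z)\<^sup>2" by simp
  ultimately have "- ((x - z)\<^sup>2 / 4) \<le> L\<^sup>2 / 4 + - (z\<^sup>2 / 8)" by linarith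
  then show ?thesis by (simp only: exp_add[symmetric] exp_le_cancel_iff)
qed

lemma integrable_exp_neg_square_mult_bounded:
  fixes g :: "real \<Rightarrow> real"
  assumes [measurable]: "g \<in> borel_measurable borel" and bdd: "\<And>z. \<bar>g z\<bar> \<le> B"
  shows "integrable lborel (\<lambda>z. exp (- (z\<^sup>2 / 8)) * g z)"
proof (rule Bochner_Integration.integrable_bound[OF integrable_mult_right[OF integrable_exp_neg_square_div_8, of B]])
  show "AE z in lborel. norm (exp (- (z\<^sup>2 / 8)) * g z) \<le> norm (B * exp (- (z\<^sup>2 / 8)))"
  proof (rule AE_I2)
    fix z
    have "\<bar>g z\<bar> \<le> \<bar>B\<bar>" using bdd[of z] by linarith
    then show "norm (exp (- (z\<^sup>2 / 8)) * g z) \<le> norm (B * exp (- (z\<^sup>2 / 8)))"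
      by (simp add: abs_mult mult.commute mult_right_mono)
  qed
qed simp

lemma integrable_heat_kernel_mult_bounded:
  fixes g :: "real \<Rightarrow> real"
  assumes [measurable]: "g \<in> borel_measurable borel" and bdd: "\<And>z. \<bar>g z\<bar> \<le> B"
  shows "integrable lborel (\<lambda>z. exp (- ((x - z)\<^sup>2 / 4)) * g z)"
proof (rule Bochner_Integration.integrable_bound)
  show "integrable lborel (\<lambda>z. exp (x\<^sup>2 / 4) * (exp (- (z\<^sup>2 / 8)) * g z))"
    by (intro integrable_mult_right integrable_exp_neg_square_mult_bounded[OF assms])
  show "AE z in lborel. norm (exp (- ((x - z)\<^sup>2 / 4)) * g z)
      \<le> norm (exp (x\<^sup>2 / 4) * (exp (- (z\<^sup>2 / 8)) * g z))"
    \<comment> \<open>No uniformity in \<open>x\<close> is at stake here, so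
      \<open>\<bar>x\<bar>\<close> itself serves as \<open>L\<close>.\<close>
    using heat_kernel_le[of x "\<bar>x\<bar>"]
    by (auto simp: abs_mult mult.assoc[symmetric] intro!: mult_right_mono)
qed simp

text \<open>For \<open>z \<noteq> 0\<close> this is \<open>u (s * z) - u (s * sgn z)\<close>. Both
  half-lines are closed, to match the integrals for \<open>F\<close>; they overlap only in the null
  set \<open>{0}\<close>.\<close>

definition step_defect :: "(real \<Rightarrow> real) \<Rightarrow> real \<Rightarrow> real \<Rightarrow> real" where
  "step_defect u s z = u (s * z) - (indicator {..0} z * u (- s) + indicator {0..} z * u s)"

lemma measurable_step_defect [measurable]:
  assumes [measurable]: "u \<in> borel_measurable borel"
  shows "step_defect u s \<in> borel_measurable borel"
  unfolding step_defect_def[abs_def] by measurable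

text \<open>Three terms survive only at \<open>z = 0\<close>, where both indicators are 1.\<close>

lemma abs_step_defect_le:
  assumes "\<And>x. \<bar>u x\<bar> \<le> B"
  shows "\<bar>step_defect u s z\<bar> \<le> 3 * B"
  using assms[of "s * z"] assms[of s] assms[of "- s"]
  by (auto simp: step_defect_def indicator_def)

lemma heat_solution_minus_F_eq:
  fixes u :: "real \<Rightarrow> real"
  assumes [measurable]: "u \<in> borel_measurable borel" and bdd: "\<And>x. \<bar>u x\<bar> \<le> B" and "s > 0"
  shows "heat_solution u (s * x) (s\<^sup>2) - (F (- x) * u (- s) + F x * u s)
    = 1 / (2 * sqrt pi) * (LBINT z. exp (- ((x - z)\<^sup>2 / 4)) * step_defect u s z)"
proof -
  let ?k = "\<lambda>z. exp (- ((x - z)\<^sup>2 / 4))"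
  \<comment> \<open>Integrability of each piece lets the simplifier split the integral by
    linearity.\<close>
  have [simp]: "integrable lborel (\<lambda>z. ?k z * u (s * z))"
    by (rule integrable_heat_kernel_mult_bounded[where B = B]) (auto simp: bdd)
  have ind [simp]: "integrable lborel (\<lambda>z. ?k z * indicator A z)" if "A \<in> sets borel" for A
    using that by (intro integrable_heat_kernel_mult_bounded[where B = 1]) (auto simp: indicator_def)
  have "(LBINT z. ?k z * step_defect u s z) = (LBINT z. ?k z * u (s * z)
      - (?k z * indicator {..0} z * u (- s) + ?k z * indicator {0..} z * u s))"
    by (simp add: step_defect_def algebra_simps)
  also have "\<dots> = (LBINT z. ?k z * u (s * z))
      - ((LBINT z. ?k z * indicator {..0} z) * u (- s) + (LBINT z. ?k z * indicator {0..} z) * u s)"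
    by simp
  finally show ?thesis
    unfolding heat_solution_rescaled[OF \<open>s > 0\<close>] F_eq_integral_left F_eq_integral_right[of x]
    by (simp add: field_simps)
qed

text \<open>The bound is free of \<open>x\<close>, so it also bounds the supremum over
  \<open>[-L, L]\<close>.\<close>

lemma abs_heat_solution_minus_F_le:
  fixes u :: "real \<Rightarrow> real"
  assumes meas [measurable]: "u \<in> borel_measurable borel" and bdd: "\<And>x. \<bar>u x\<bar> \<le> B"
    and "s > 0" and x: "\<bar>x\<bar> \<le> L"
  shows "\<bar>heat_solution u (s * x) (s\<^sup>2) - (F (- x) * u (- s) + F x * u s)\<bar>
    \<le> exp (L\<^sup>2 / 4) / (2 * sqrt pi) * (LBINT z. exp (- (z\<^sup>2 / 8)) * \<bar>step_defect u s z\<bar>)"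
proof -
  have "\<bar>LBINT z. exp (- ((x - z)\<^sup>2 / 4)) * step_defect u s z\<bar>
      \<le> (LBINT z. exp (L\<^sup>2 / 4) * (exp (- (z\<^sup>2 / 8)) * \<bar>step_defect u s z\<bar>))"
  proof (rule integral_abs_bound[THEN order_trans], rule integral_mono)
    show "integrable lborel (\<lambda>z. \<bar>exp (- ((x - z)\<^sup>2 / 4)) * step_defect u s z\<bar>)"
      by (intro integrable_abs integrable_heat_kernel_mult_bounded[where B = "3 * B"]
          abs_step_defect_le bdd) measurable
    show "integrable lborel (\<lambda>z. exp (L\<^sup>2 / 4) * (exp (- (z\<^sup>2 / 8)) * \<bar>step_defect u s z\<bar>))"
      by (intro integrable_mult_right integrable_exp_neg_square_mult_bounded[where B = "3 * B"])
        (auto intro: abs_step_defect_le bdd)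
  qed (use heat_kernel_le[OF x] in
      \<open>auto simp: abs_mult mult.assoc[symmetric] intro!: mult_right_mono\<close>)
  also have "\<dots> = exp (L\<^sup>2 / 4) * (LBINT z. exp (- (z\<^sup>2 / 8)) * \<bar>step_defect u s z\<bar>)"
    by simp
  finally show ?thesis
    unfolding heat_solution_minus_F_eq[OF meas bdd \<open>s > 0\<close>]
    by (simp add: abs_mult divide_right_mono)
qed

text \<open>On either side of 0 the defect is a difference of dilations by
  \<open>\<bar>z\<bar>\<close> and 1, of \<open>u\<close> itself for \<open>z > 0\<close> and of its
  reflection for \<open>z < 0\<close>.\<close>

lemma tendsto_step_defect:
  fixes u u' :: "real \<Rightarrow> real"
  assumes deriv: "\<And>x. x \<noteq> 0 \<Longrightarrow> (u has_real_derivative u' x) (at x)"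
    and lim: "((\<lambda>x. x * u' x) \<longlongrightarrow> 0) at_infinity"
    and "z \<noteq> 0"
  shows "((\<lambda>s. step_defect u s z) \<longlongrightarrow> 0) at_top"
proof (cases "z > 0")
  case True
  have "((\<lambda>s. u (s * z) - u (s * 1)) \<longlongrightarrow> 0) at_top"
    using True deriv filterlim_mono[OF lim order_refl at_top_le_at_infinity]
    by (intro tendsto_diff_dilation[of u u']) auto
  then show ?thesis using True by (simp add: step_defect_def)
next
  case False
  have "((\<lambda>x. - x * u' (- x)) \<longlongrightarrow> 0) at_top"
    using filterlim_compose[OF filterlim_mono[OF lim order_refl at_bot_le_at_infinity]
        filterlim_uminus_at_bot_at_top] by simp
  moreover have "((\<lambda>x. u (- x)) has_real_derivative - u' (- x)) (at x)" if "x > 0" for x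
    using DERIV_chain2[OF deriv[of "- x"] DERIV_minus[OF DERIV_ident]] that by simp
  \<comment> \<open>The double sign exhibits the positive factor \<open>- z\<close> for the
    reflected function.\<close>
  ultimately have "((\<lambda>s. u (- (s * - z)) - u (- (s * 1))) \<longlongrightarrow> 0) at_top"
    using False \<open>z \<noteq> 0\<close>
    by (intro tendsto_diff_dilation[of "\<lambda>x. u (- x)" "\<lambda>x. - u' (- x)"]) auto
  then show ?thesis using False \<open>z \<noteq> 0\<close> by (simp add: step_defect_def)
qed

lemma tendsto_integral_step_defect:
  fixes u u' :: "real \<Rightarrow> real"
  assumes [measurable]: "u \<in> borel_measurable borel" and bdd: "\<And>x. \<bar>u x\<bar> \<le> B"
    and deriv: "\<And>x. x \<noteq> 0 \<Longrightarrow> (u has_real_derivative u' x) (at x)"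
    and lim: "((\<lambda>x. x * u' x) \<longlongrightarrow> 0) at_infinity"
  shows "((\<lambda>s. LBINT z. exp (- (z\<^sup>2 / 8)) * \<bar>step_defect u s z\<bar>) \<longlongrightarrow> 0) at_top"
proof -
  have "((\<lambda>s. LBINT z. exp (- (z\<^sup>2 / 8)) * \<bar>step_defect u s z\<bar>) \<longlongrightarrow> (LBINT z::real. 0)) at_top"
  proof (rule integral_dominated_convergence_at_top)
    show "integrable lborel (\<lambda>z::real. 3 * B * exp (- (z\<^sup>2 / 8)))"
      by (intro integrable_mult_right integrable_exp_neg_square_div_8)
    show "\<forall>\<^sub>F s in at_top. AE z in lborel.
        norm (exp (- (z\<^sup>2 / 8)) * \<bar>step_defect u s z\<bar>) \<le> 3 * B * exp (- (z\<^sup>2 / 8))"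
      using abs_step_defect_le[OF bdd]
      by (intro always_eventually allI AE_I2) (simp add: abs_mult mult.commute)
    show "AE z in lborel. ((\<lambda>s. exp (- (z\<^sup>2 / 8)) * \<bar>step_defect u s z\<bar>) \<longlongrightarrow> 0) at_top"
      \<comment> \<open>The pointwise limit is available only for
        \<open>z \<noteq> 0\<close>.\<close>
      using AE_lborel_singleton[of 0]
      by eventually_elim
        (intro tendsto_mult_right_zero tendsto_rabs_zero tendsto_step_defect[OF deriv lim])
  qed measurable
  then show ?thesis by simp
qed

theorem theorem3:
  fixes u0 :: "real \<Rightarrow> real" and L :: real
  assumes "bounded (range u0)"
    and "u0 C1_differentiable_on (UNIV - {0})"
    and "((\<lambda>x. \<bar>x * deriv u0 x\<bar>) \<longlongrightarrow> 0) at_infinity"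
    and "L > 0"
  shows "((\<lambda>t. SUP x\<in>{-L..L}.
            ereal \<bar>heat_solution u0 (sqrt t * x) t
                   - (F (- x) * u0 (- sqrt t) + F x * u0 (sqrt t))\<bar>) \<longlongrightarrow> 0) at_top"
proof -
  obtain B where B: "\<And>x. \<bar>u0 x\<bar> \<le> B"
    using assms(1) by (auto simp: bounded_iff)
  \<comment> \<open>Continuity away from a countable set, here \<open>{0}\<close>, is enough for
    measurability.\<close>
  have meas: "u0 \<in> borel_measurable borel"
    using C1_differentiable_imp_continuous_on[OF assms(2)]
    by (intro borel_measurable_continuous_countable_exceptions[of "{0}"]) (auto simp: Compl_eq_Diff_UNIV)
  have deriv: "(u0 has_real_derivative deriv u0 x) (at x)" if "x \<noteq> 0" for x
  proof -
    obtain D where "(u0 has_vector_derivative D x) (at x)"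
      using assms(2) \<open>x \<noteq> 0\<close> by (auto simp: C1_differentiable_on_def)
    then show ?thesis
      by (metis DERIV_imp_deriv has_real_derivative_iff_has_vector_derivative)
  qed
  have lim: "((\<lambda>x. x * deriv u0 x) \<longlongrightarrow> 0) at_infinity"
    using assms(3) by (rule tendsto_rabs_zero_cancel)
  define g where "g t = exp (L\<^sup>2 / 4) / (2 * sqrt pi)
      * (LBINT z. exp (- (z\<^sup>2 / 8)) * \<bar>step_defect u0 (sqrt t) z\<bar>)" for t
  have "(g \<longlongrightarrow> 0) at_top"
    unfolding g_def[abs_def]
    by (intro tendsto_mult_right_zero
        filterlim_compose[OF tendsto_integral_step_defect[OF meas B deriv lim] sqrt_at_top])
  then have g: "((\<lambda>t. ereal (g t)) \<longlongrightarrow> 0) at_top"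
    by (simp add: zero_ereal_def)
  show ?thesis
  proof (rule tendsto_sandwich[OF _ _ tendsto_const g])
    show "\<forall>\<^sub>F t in at_top. 0 \<le> (SUP x\<in>{-L..L}.
            ereal \<bar>heat_solution u0 (sqrt t * x) t
                   - (F (- x) * u0 (- sqrt t) + F x * u0 (sqrt t))\<bar>)"
      \<comment> \<open>The point \<open>x = 0\<close> lies in the interval; over an empty set the
        supremum in \<open>ereal\<close> would be \<open>-\<infinity>\<close>.\<close>
      using \<open>L > 0\<close> by (intro always_eventually allI SUP_upper2[of 0]) auto
    show "\<forall>\<^sub>F t in at_top. (SUP x\<in>{-L..L}.
            ereal \<bar>heat_solution u0 (sqrt t * x) t
                   - (F (- x) * u0 (- sqrt t) + F x * u0 (sqrt t))\<bar>) \<le> ereal (g t)"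
      using eventually_gt_at_top[of 0]
    proof eventually_elim
      case (elim t)
      then have "\<bar>heat_solution u0 (sqrt t * x) t - (F (- x) * u0 (- sqrt t) + F x * u0 (sqrt t))\<bar> \<le> g t"
        if "x \<in> {-L..L}" for x
        using abs_heat_solution_minus_F_le[OF meas B, of "sqrt t" x L] that by (simp add: g_def abs_le_iff[of x])
      then show ?case
        by (intro SUP_least) simp
    qed
  qed
qed

end
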